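(* Let $P$ be a polytope. The following are equivalent: (i) $P$ is affinely equivalent to a Cartesian product of simplices; (ii) for every family of faces $(F_i)_{i\in I}$ of $P$, \[\mathrm{aff}\Big(\bigcap_{i\in I}F_i\Big)=\bigcap_{i\in I}\mathrm{aff}(F_i).\]
   Context: $\mathrm{aff}(X)$ denotes the affine hull of a subset $X$ of a finite-dimensional real vector space, with the convention $\mathrm{aff}(\emptyset)=\emptyset$. Faces of $P$ include possibly the empty face. *)

theory Defs
  imports "HOL-Analysis.Analysis"
begin

text \<open>Standard model of the Cartesian product of simplices
  \<open>\<Delta>_{d_0} \<times> ... \<times> \<Delta>_{d_{k-1}}\<close>, where \<open>ds = [d_0,...,d_{k-1}]\<close> and
  the i-th factor is the standard d_i-simplex in \<open>R^{d_i+1}\<close>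
  (coordinates \<open>x i 0, ..., x i d_i\<close>). All other coordinates are 0.\<close>
definition prod_simplices :: "nat list \<Rightarrow> (nat \<Rightarrow> nat \<Rightarrow> real) set" where
  "prod_simplices ds =
     {x. (\<forall>i<length ds. (\<forall>j\<le>ds!i. 0 \<le> x i j) \<and> (\<Sum>j\<le>ds!i. x i j) = 1) \<and>
         (\<forall>i j. \<not> (i < length ds \<and> j \<le> ds!i) \<longrightarrow> x i j = 0)}"

definition coord_affine :: "('a::real_vector \<Rightarrow> nat \<Rightarrow> nat \<Rightarrow> real) \<Rightarrow> bool" where
  "coord_affine f \<longleftrightarrow>
     (\<forall>x y u i j. f (u *\<^sub>R x + (1 - u) *\<^sub>R y) i j = u * f x i j + (1 - u) * f y i j)"

definition aff_equiv_prod_simplices :: "'a::real_vector set \<Rightarrow> bool" where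
  "aff_equiv_prod_simplices P \<longleftrightarrow>
     (\<exists>ds f. coord_affine f \<and> inj_on f (affine hull P) \<and> f ` P = prod_simplices ds)"

end

theory Submission
  imports Defs
begin

text \<open>
  In a product of simplices a face is cut out by the barycentric coordinates vanishing on it, and its
  affine hull by the same equations. If a point lies in all the hulls, no row of coordinates
  is forced to vanish entirely, so some point of the product is positive off the union of the
  vanishing sets; it lies in the relative interior of the intersection of the faces.

  Conversely, write the polytope irredundantly as \<open>{x \<in> A. g\<^sub>k x \<ge> 0, k \<in> K}\<close>. The hull condition
  makes it simple. It also shows that a minimal set \<open>M\<close> of facets without common point satisfies
  a relation \<open>\<Sum>k\<in>M. c\<^sub>k g\<^sub>k = 1\<close> on \<open>A\<close> with positive weights. Simplicity makes these sets
  pairwise disjoint, boundedness makes them cover \<open>K\<close>, and the functions \<open>c\<^sub>k g\<^sub>k\<close> with \<open>k \<in> M\<close>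
  are then the barycentric coordinates of one simplex factor.
\<close>

section \<open>Short steps and affine combinations\<close>

text \<open>Each strictly positive value tolerates a short step, and finitely many positive bounds
  have a positive minimum. It serves to move a point with positive slacks a little in any given
  direction.\<close>

lemma exists_common_step:
  fixes \<alpha> \<beta> :: "'k \<Rightarrow> real"
  assumes "finite K" and "\<And>k. k \<in> K \<Longrightarrow> 0 < \<alpha> k"
  shows "\<exists>e>0. \<forall>k\<in>K. 0 \<le> \<alpha> k + e * \<beta> k"
  using assms
proof (induction K rule: finite_induct)
  case empty
  show ?case by (intro exI[of _ 1]) simp
next
  case (insert k K)
  then obtain e where e: "e > 0" "\<forall>l\<in>K. 0 \<le> \<alpha> l + e * \<beta> l" by auto
  have pos: "0 < \<alpha> k" using insert.prems by simp
  define e' where "e' = min e (\<alpha> k / (\<bar>\<beta> k\<bar> + 1))"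
  have e': "0 < e'" "e' \<le> e" using e pos by (auto simp: e'_def)
  have "e' \<le> \<alpha> k / (\<bar>\<beta> k\<bar> + 1)" by (simp add: e'_def)
  then have "e' * (\<bar>\<beta> k\<bar> + 1) \<le> \<alpha> k" by (subst (asm) pos_le_divide_eq) auto
  then have "e' * \<bar>\<beta> k\<bar> \<le> \<alpha> k" using e' by (simp add: distrib_left)
  then have k: "0 \<le> \<alpha> k + e' * \<beta> k"
    using e' by (smt (verit, best) mult_minus_right mult_left_mono)
  have "0 \<le> \<alpha> l + e' * \<beta> l" if "l \<in> K" for l
  proof (cases "0 \<le> \<beta> l")
    case True
    then show ?thesis using insert.prems[of l] that e' by (simp add: less_imp_le)
  next
    case False
    then have "e * \<beta> l \<le> e' * \<beta> l" using e' by (intro mult_right_mono_neg) auto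
    then show ?thesis using e that by force
  qed
  with k e' show ?case by auto
qed

lemma affine_add_sum_diff:
  assumes "affine A" and "x \<in> A" and "finite I"
    and "\<And>i. i \<in> I \<Longrightarrow> p i \<in> A" and "\<And>i. i \<in> I \<Longrightarrow> q i \<in> A"
  shows "x + (\<Sum>i\<in>I. t i *\<^sub>R (p i - q i)) \<in> A"
  using assms(3-5)
proof (induction I rule: finite_induct)
  case empty
  show ?case using assms by simp
next
  case (insert i I)
  have "(x + (\<Sum>i\<in>I. t i *\<^sub>R (p i - q i))) + t i *\<^sub>R (p i - q i) \<in> A"
    using insert assms(1) by (intro mem_affine_3_minus) auto
  then show ?case using insert by (simp add: algebra_simps)
qed

text \<open>Solving for \<open>x\<close> writes it as an affine combination of \<open>z\<close> and
  the stepped point. Paired with \<open>exists_common_step\<close>: a point lies in a hull once a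
  short step towards it stays in the set.\<close>

lemma affine_hull_extrapolate:
  assumes "z \<in> S" and "e *\<^sub>R x + (1 - e) *\<^sub>R z \<in> S" and "e \<noteq> 0"
  shows "x \<in> affine hull S"
proof -
  have "(1 / e) *\<^sub>R (e *\<^sub>R x + (1 - e) *\<^sub>R z) + (1 - 1 / e) *\<^sub>R z \<in> affine hull S"
    by (rule mem_affine) (use assms in \<open>auto simp: hull_inc\<close>)
  moreover have "(1 / e) *\<^sub>R ((1 - e) *\<^sub>R z) + (1 - 1 / e) *\<^sub>R z = ((1 / e) * (1 - e) + (1 - 1 / e)) *\<^sub>R z"
    by (simp only: scaleR_add_left scaleR_scaleR)
  moreover have "(1 / e) * (1 - e) + (1 - 1 / e) = 0" using assms(3) by (simp add: field_simps)
  ultimately show ?thesis using assms(3) by (simp add: scaleR_add_right add.assoc)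
qed

subsection \<open>Products of simplices\<close>

text \<open>A point \<open>p\<close> of the relative interior of \<open>F\<close> is positive in
  every coordinate of \<open>K\<close> that does not vanish identically on \<open>F\<close>. Hence
  the segment from \<open>y\<close> to \<open>p\<close> can be prolonged beyond \<open>p\<close>
  inside \<open>P\<close>, and the defining property of a face puts \<open>y\<close> in
  \<open>F\<close>.\<close>

lemma coord_affine_face_mem:
  fixes P :: "'a::euclidean_space set"
  assumes f: "coord_affine f" and fin: "finite K"
    and P: "P = {x \<in> A. \<forall>(i, j)\<in>K. 0 \<le> f x i j}" and A: "affine A"
    and F: "F face_of P" "F \<noteq> {}"
    and y: "y \<in> P" "\<And>i j. (i, j) \<in> K \<Longrightarrow> \<forall>x\<in>F. f x i j = 0 \<Longrightarrow> f y i j = 0"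
  shows "y \<in> F"
proof -
  have conv: "convex F" and sub: "F \<subseteq> P"
    using F face_of_imp_convex face_of_imp_subset by blast+
  obtain p where p: "p \<in> rel_interior F"
    using conv F rel_interior_eq_empty by blast
  then have pF: "p \<in> F" using rel_interior_subset by blast
  have pos: "0 < f p i j" if ij: "(i, j) \<in> K" and nz: "\<exists>x\<in>F. f x i j \<noteq> 0" for i j
  proof -
    obtain x where x: "x \<in> F" "f x i j \<noteq> 0" using nz by blast
    have "x \<in> P" "p \<in> P" using sub x pF by auto
    then have *: "0 < f x i j" "0 \<le> f p i j" using ij x unfolding P by force+
    \<comment> \<open>The segment from \<open>x\<close> extends beyond \<open>p\<close> within
      \<open>F\<close>; a zero coordinate at \<open>p\<close> would be negative there.\<close>
    obtain e where e: "e > 1" "(1 - e) *\<^sub>R x + e *\<^sub>R p \<in> F"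
      using convex_rel_interior_iff[OF conv] F p x by blast
    have "0 \<le> f ((1 - e) *\<^sub>R x + e *\<^sub>R p) i j"
      using e sub ij unfolding P by force
    also have "\<dots> = (1 - e) * f x i j + e * f p i j"
      using f[unfolded coord_affine_def, rule_format, of "1 - e" x p i j] by simp
    finally have "(e - 1) * f x i j \<le> e * f p i j" by (simp add: algebra_simps)
    moreover have "0 < (e - 1) * f x i j" using * e by simp
    ultimately have "0 < e * f p i j" by linarith
    then show ?thesis using e zero_less_mult_pos by fastforce
  qed
  define K' where "K' = {(i, j) \<in> K. \<exists>x\<in>F. f x i j \<noteq> 0}"
  have "finite K'" using fin unfolding K'_def by (rule finite_subset[rotated]) auto
  then have "\<exists>e>0. \<forall>k\<in>K'. 0 \<le> (case k of (i, j) \<Rightarrow> f p i j)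
      + e * (case k of (i, j) \<Rightarrow> f p i j - f y i j)"
    by (rule exists_common_step) (use pos in \<open>auto simp: K'_def\<close>)
  then obtain e where e: "e > 0"
    "\<And>i j. (i, j) \<in> K' \<Longrightarrow> 0 \<le> f p i j + e * (f p i j - f y i j)" by fast
  \<comment> \<open>The point reached from \<open>y\<close> by overshooting \<open>p\<close> by the
    factor \<open>e\<close>.\<close>
  define q where "q = (1 + e) *\<^sub>R p + (1 - (1 + e)) *\<^sub>R y"
  have "q \<in> A" using A pF sub y(1) unfolding q_def P by (intro mem_affine) auto
  moreover have "0 \<le> f q i j" if ij: "(i, j) \<in> K" for i j
  proof -
    have q: "f q i j = f p i j + e * (f p i j - f y i j)"
      using f[unfolded coord_affine_def, rule_format, of "1 + e" p y i j]
      unfolding q_def by (simp add: algebra_simps)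
    show ?thesis
    proof (cases "(i, j) \<in> K'")
      case False
      then have "\<forall>x\<in>F. f x i j = 0" using ij by (auto simp: K'_def)
      then show ?thesis using q y(2)[OF ij] pF by simp
    qed (use q e in auto)
  qed
  ultimately have "q \<in> P" unfolding P by auto
  show ?thesis
  proof (cases "y = p")
    case False
    \<comment> \<open>The parameter of \<open>p\<close> on the segment from \<open>y\<close> to
      \<open>q\<close>.\<close>
    define r where "r = 1 / (1 + e)"
    have r: "0 < r" "r < 1" "r * (1 + e) = 1" "r * e = 1 - r" using e by (auto simp: r_def field_simps)
    have "p = (r * (1 + e)) *\<^sub>R p" using r by simp
    also have "\<dots> = r *\<^sub>R (e *\<^sub>R y + q)" by (simp add: q_def)
    also have "\<dots> = (1 - r) *\<^sub>R y + r *\<^sub>R q" by (simp add: scaleR_add_right r)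
    finally have "p = (1 - r) *\<^sub>R y + r *\<^sub>R q" .
    moreover have "y \<noteq> q"
    proof
      assume "y = q"
      then have "(1 + e) *\<^sub>R (p - y) = 0" by (simp add: q_def algebra_simps)
      then show False using e False by simp
    qed
    ultimately have "p \<in> open_segment y q"
      unfolding in_segment using r by blast
    then show ?thesis using F(1) pF y(1) \<open>q \<in> P\<close> unfolding face_of_def by blast
  qed (use pF in simp)
qed

lemma prod_simplices_affine_hull_Inter_faces:
  fixes P :: "'a::euclidean_space set"
  assumes prod: "aff_equiv_prod_simplices P" and \<F>: "\<F> \<subseteq> {F. F face_of P}"
  shows "affine hull (\<Inter>\<F>) = (\<Inter>F\<in>\<F>. affine hull F)"
proof
  show "affine hull (\<Inter>\<F>) \<subseteq> (\<Inter>F\<in>\<F>. affine hull F)"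
    by (meson INF_greatest Inter_lower hull_mono)
next
  obtain ds f where f: "coord_affine f" and inj: "inj_on f (affine hull P)"
    and im: "f ` P = prod_simplices ds"
    using prod unfolding aff_equiv_prod_simplices_def by blast
  have f_aff: "f (u *\<^sub>R x + v *\<^sub>R y) i j = u * f x i j + v * f y i j" if "u + v = 1" for u v x y i j
    using f that unfolding coord_affine_def by (metis add_diff_cancel_left')
  define A where "A = affine hull P"
  have affA: "affine A" and PA: "P \<subseteq> A" by (auto simp: A_def hull_subset)
  \<comment> \<open>The genuine coordinates of the model; all others are zero padding.\<close>
  define K where "K = (SIGMA i:{..<length ds}. {..ds ! i})"
  have finK: "finite K" by (simp add: K_def)
  have eqs: "(\<forall>i<length ds. (\<Sum>j\<le>ds!i. f x i j) = 1) \<and>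
         (\<forall>i j. \<not> (i < length ds \<and> j \<le> ds!i) \<longrightarrow> f x i j = 0)" if "x \<in> A" for x
  proof -
    \<comment> \<open>Row sums and padding are affine conditions, so they pass from \<open>P\<close>
      to its hull \<open>A\<close>; only the sign conditions are lost.\<close>
    let ?E = "{x. (\<forall>i<length ds. (\<Sum>j\<le>ds!i. f x i j) = 1) \<and>
         (\<forall>i j. \<not> (i < length ds \<and> j \<le> ds!i) \<longrightarrow> f x i j = 0)}"
    have "affine ?E"
      unfolding affine_def
      by (auto simp: f_aff sum.distrib simp flip: sum_distrib_left)
    moreover have "P \<subseteq> ?E" using im unfolding prod_simplices_def by fast
    ultimately have "A \<subseteq> ?E" unfolding A_def by (intro hull_minimal)
    then show ?thesis using that by blast
  qed
  have P: "P = {x \<in> A. \<forall>(i, j)\<in>K. 0 \<le> f x i j}"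
  proof (intro equalityI subsetI)
    fix x assume "x \<in> P"
    then have "f x \<in> prod_simplices ds" using im by blast
    then show "x \<in> {x \<in> A. \<forall>(i, j)\<in>K. 0 \<le> f x i j}"
      using \<open>x \<in> P\<close> PA by (auto simp: prod_simplices_def K_def)
  next
    fix x assume x: "x \<in> {x \<in> A. \<forall>(i, j)\<in>K. 0 \<le> f x i j}"
    then have "f x \<in> prod_simplices ds"
      using eqs[of x] unfolding prod_simplices_def K_def by auto
    then obtain p where "p \<in> P" "f p = f x" using im by (metis imageE)
    then show "x \<in> P" using inj x PA unfolding A_def by (metis (no_types, lifting) inj_onD mem_Collect_eq subsetD)
  qed
  show "(\<Inter>F\<in>\<F>. affine hull F) \<subseteq> affine hull (\<Inter>\<F>)"
  proof
    fix x assume x: "x \<in> (\<Inter>F\<in>\<F>. affine hull F)"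
    show "x \<in> affine hull (\<Inter>\<F>)"
    proof (cases "\<F> = {}")
      \<comment> \<open>For the empty family both sides are the whole space.\<close>
      case True
      then show ?thesis by (simp add: hull_UNIV)
    next
      case False
      have ne: "F \<noteq> {}" if "F \<in> \<F>" for F using x that by force
      have FP: "F \<subseteq> P" if "F \<in> \<F>" for F using \<F> that face_of_imp_subset by blast
      have xA: "x \<in> A" using False x FP unfolding A_def
        by (metis INT_iff all_not_in_conv hull_mono subsetD)
      \<comment> \<open>The coordinates that vanish on at least one member of the family.\<close>
      define S where "S = {(i, j) \<in> K. \<exists>F\<in>\<F>. \<forall>y\<in>F. f y i j = 0}"
      have xS: "f x i j = 0" if ij: "(i, j) \<in> S" for i j
      proof -
        obtain F where F: "F \<in> \<F>" "\<forall>y\<in>F. f y i j = 0" using ij by (auto simp: S_def)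
        have "affine {y. f y i j = 0}" unfolding affine_def by (auto simp: f_aff)
        then have "affine hull F \<subseteq> {y. f y i j = 0}" using F by (intro hull_minimal) auto
        then show ?thesis using x F by blast
      qed
      have mem: "y \<in> \<Inter>\<F>" if "y \<in> P" "\<And>i j. (i, j) \<in> S \<Longrightarrow> f y i j = 0" for y
      proof
        fix F assume F: "F \<in> \<F>"
        show "y \<in> F"
        proof (rule coord_affine_face_mem[OF f finK P affA])
          fix i j assume "(i, j) \<in> K" "\<forall>x\<in>F. f x i j = 0"
          then have "(i, j) \<in> S" using F unfolding S_def by blast
          then show "f y i j = 0" by (rule that(2))
        qed (use F \<F> ne that(1) in blast)+
      qed
      define N where "N i = {j \<in> {..ds ! i}. (i, j) \<notin> S}" for i
      \<comment> \<open>Uniform weights, in each row, on the coordinates outside \<open>S\<close>: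
        the preimage \<open>z\<close> will be a point of the intersection that is positive wherever
        \<open>S\<close> permits.\<close>
      define w where "w i j = (if (i, j) \<in> K - S then 1 / real (card (N i)) else 0)" for i j
      have card: "0 < card (N i)" if i: "i < length ds" for i
      proof -
        \<comment> \<open>The row of \<open>x\<close> sums to 1 and vanishes on \<open>S\<close>, so
          it has an entry outside \<open>S\<close>.\<close>
        have "(\<Sum>j\<le>ds!i. f x i j) \<noteq> 0" using eqs[OF xA] i by simp
        then obtain j where "j \<le> ds ! i" "f x i j \<noteq> 0" by (metis atMost_iff sum.neutral)
        then have "j \<in> N i" using xS by (auto simp: N_def)
        then show ?thesis by (auto simp: card_gt_0_iff N_def)
      qed
      have "w \<in> prod_simplices ds"
      proof -
        have "(\<Sum>j\<le>ds!i. w i j) = 1" if i: "i < length ds" for i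
        proof -
          have "(\<Sum>j\<le>ds!i. w i j) = (\<Sum>j\<in>N i. w i j)"
            by (rule sum.mono_neutral_right) (auto simp: N_def w_def)
          also have "\<dots> = (\<Sum>j\<in>N i. 1 / real (card (N i)))"
            using i by (intro sum.cong) (auto simp: N_def w_def K_def)
          finally show ?thesis using card[OF i] by simp
        qed
        then show ?thesis by (auto simp: prod_simplices_def w_def K_def)
      qed
      then obtain z where z: "z \<in> P" "f z = w" using im by (metis imageE)
      have z_in: "z \<in> \<Inter>\<F>" by (rule mem) (use z in \<open>auto simp: w_def\<close>)
      have "\<exists>e>0. \<forall>k\<in>K - S. 0 \<le> w (fst k) (snd k) + e * (f x (fst k) (snd k) - w (fst k) (snd k))"
        by (rule exists_common_step) (use finK card in \<open>auto simp: w_def K_def\<close>)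
      then obtain e where "e > 0"
        and step: "\<forall>k\<in>K - S. 0 \<le> w (fst k) (snd k) + e * (f x (fst k) (snd k) - w (fst k) (snd k))"
        by blast
      have e: "e > 0" "\<And>i j. (i, j) \<in> K - S \<Longrightarrow> 0 \<le> w i j + e * (f x i j - w i j)"
        using \<open>e > 0\<close> bspec[OF step] by fastforce+
      \<comment> \<open>A short step from \<open>z\<close> towards \<open>x\<close>: coordinates in
        \<open>S\<close> remain zero and the others remain nonnegative.\<close>
      define y where "y = e *\<^sub>R x + (1 - e) *\<^sub>R z"
      have fy: "f y i j = w i j + e * (f x i j - w i j)" for i j
        using f_aff[of e "1 - e" x z i j] z by (simp add: y_def left_diff_distrib right_diff_distrib)
      have yS: "f y i j = 0" if "(i, j) \<in> S" for i j
        using xS[OF that] that by (simp add: fy w_def)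
      have "y \<in> A" unfolding y_def using affA xA z PA by (intro mem_affine) auto
      moreover have "0 \<le> f y i j" if "(i, j) \<in> K" for i j
        using e(2)[of i j] yS[of i j] that fy[of i j] by (cases "(i, j) \<in> S") auto
      ultimately have "y \<in> P" unfolding P by auto
      then have "y \<in> \<Inter>\<F>" using yS by (rule mem)
      then show ?thesis
        using affine_hull_extrapolate[of z _ e x] z_in e(1) unfolding y_def by simp
    qed
  qed
qed


subsection \<open>Polytopes whose faces have compatible affine hulls\<close>

text \<open>The \<open>g k\<close> are the slacks of the facet inequalities, the polytope is
  \<open>face {}\<close>, and \<open>face S\<close> is the part where the inequalities in
  \<open>S\<close> are tight. Condition (ii) enters only through \<open>hull\<close>, that is, for
  intersections of facets.\<close>

locale face_hull_system =
  fixes A :: "'a::euclidean_space set" and K :: "'k set" and a :: "'k \<Rightarrow> 'a" and b :: "'k \<Rightarrow> real"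
    and g :: "'k \<Rightarrow> 'a \<Rightarrow> real" and face :: "'k set \<Rightarrow> 'a set"
  assumes g_def: "g k x = b k - a k \<bullet> x"
    and face_def: "face S = {x \<in> A. (\<forall>k\<in>K. 0 \<le> g k x) \<and> (\<forall>k\<in>S. g k x = 0)}"
    and affine_A: "affine A" and finite_K: "finite K"
    and nonempty: "face {} \<noteq> {}" and bounded: "bounded (face {})"
    and proper: "l \<in> K \<Longrightarrow> \<exists>x\<in>face {}. g l x \<noteq> 0"
    and irredundant: "k \<in> K \<Longrightarrow> l \<in> K \<Longrightarrow> k \<noteq> l \<Longrightarrow> \<exists>x\<in>face {k}. g l x \<noteq> 0"
    and hull: "S \<subseteq> K \<Longrightarrow> {x \<in> A. \<forall>k\<in>S. g k x = 0} \<subseteq> affine hull (face S)"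
begin

lemma face_iff: "x \<in> face S \<longleftrightarrow> x \<in> A \<and> (\<forall>k\<in>K. 0 \<le> g k x) \<and> (\<forall>k\<in>S. g k x = 0)"
  by (simp add: face_def)

lemma face_antimono: "S \<subseteq> T \<Longrightarrow> face T \<subseteq> face S"
  by (auto simp: face_def)

lemma g_add_sum_diff:
  "g k (x + (\<Sum>i\<in>I. t i *\<^sub>R (p i - q i))) = g k x + (\<Sum>i\<in>I. t i * (g k (p i) - g k (q i)))"
proof -
  have "(\<Sum>i\<in>I. t i * (g k (p i) - g k (q i))) = - (\<Sum>i\<in>I. t i * (a k \<bullet> p i - a k \<bullet> q i))"
    unfolding sum_negf[symmetric] by (intro sum.cong) (auto simp: g_def algebra_simps)
  then show ?thesis
    by (simp add: g_def inner_add_right inner_sum_right inner_diff_right)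
qed

lemma g_add_diff: "g k (x + t *\<^sub>R (p - q)) = g k x + t * (g k p - g k q)"
  by (simp add: g_def inner_add_right inner_diff_right algebra_simps)

text \<open>The zero set of \<open>g l\<close> is affine, so it contains the hull of
  \<open>face S\<close>, and \<open>hull\<close> places every common zero of the equations in that
  hull.\<close>

lemma vanish_on_hull:
  assumes "S \<subseteq> K" and "\<And>y. y \<in> face S \<Longrightarrow> g l y = 0" and "x \<in> A" and "\<And>k. k \<in> S \<Longrightarrow> g k x = 0"
  shows "g l x = 0"
proof -
  have "affine hull (face S) \<subseteq> {x. a l \<bullet> x = b l}"
    by (intro hull_minimal affine_hyperplane) (use assms(2) in \<open>auto simp: g_def\<close>)
  moreover have "x \<in> affine hull (face S)" using hull[OF assms(1)] assms by blast
  ultimately show ?thesis by (auto simp: g_def)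
qed

text \<open>This is simplicity of the polytope. In a minimal counterexample \<open>S\<close>, the function \<open>g l\<close> is a
  positive combination of the \<open>g k\<close> with \<open>k \<in> S\<close>. Replacing two of these equations by \<open>g l = 0\<close>
  does not enlarge the face but does enlarge its affine hull.\<close>

lemma face_not_subset_facet:
  assumes "S \<subseteq> K" and "face S \<noteq> {}" and "l \<in> K" and "l \<notin> S"
  shows "\<exists>x\<in>face S. 0 < g l x"
proof -
  have "finite S" using assms(1) finite_K finite_subset by blast
  then have "\<exists>x\<in>face S. g l x \<noteq> 0" using assms
  proof (induction S rule: finite_psubset_induct)
    case (psubset S)
    consider "S = {}" | k where "S = {k}" | k m where "k \<in> S" "m \<in> S" "k \<noteq> m" by blast
    then show ?case
    proof cases
      case 1
      then show ?thesis using proper \<open>l \<in> K\<close> by simp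
    next
      case 2
      then show ?thesis using irredundant[of k l] psubset.prems by auto
    next
      case 3
      show ?thesis
      proof (rule ccontr)
        assume "\<not> ?thesis"
        then have zero: "g l y = 0" if "y \<in> face S" for y using that by blast
        obtain v where v: "v \<in> face S" using psubset.prems by blast
        \<comment> \<open>The induction hypothesis for \<open>S - {n}\<close> gives a point with
          \<open>g l\<close> nonzero. It cannot lie in \<open>face S\<close>, so \<open>g n\<close>
          is nonzero there as well.\<close>
        have ex: "\<exists>x\<in>face (S - {n}). 0 < g l x \<and> 0 < g n x" if n: "n \<in> S" for n
        proof -
          have "S - {n} \<subset> S" "face (S - {n}) \<noteq> {}"
            using n face_antimono[of "S - {n}" S] psubset.prems by auto
          then obtain x where x: "x \<in> face (S - {n})" "g l x \<noteq> 0"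
            using psubset.IH[of "S - {n}"] psubset.prems by blast
          then have "x \<notin> face S" using zero by blast
          then have "g n x \<noteq> 0" using x unfolding face_iff by blast
          moreover have "0 \<le> g n x" "0 \<le> g l x" using x n psubset.prems unfolding face_iff by blast+
          ultimately show ?thesis using x by (intro bexI[of _ x]) auto
        qed
        obtain x where x: "x \<in> face (S - {k})" "0 < g l x" "0 < g k x" using ex 3 by blast
        obtain y where y: "y \<in> face (S - {m})" "0 < g l y" "0 < g m y" using ex 3 by blast
        have inA: "x \<in> A" "y \<in> A" "v \<in> A" using x y v by (auto simp: face_iff)
        have v0: "g n v = 0" if "n \<in> S" for n using v that by (simp add: face_iff)
        have vl: "g l v = 0" using zero v by simp
        have x0: "g n x = 0" if "n \<in> S" "n \<noteq> k" for n using x that by (simp add: face_iff)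
        have y0: "g n y = 0" if "n \<in> S" "n \<noteq> m" for n using y that by (simp add: face_iff)
        \<comment> \<open>The equation of \<open>l\<close> replaces those of \<open>k\<close> and
          \<open>m\<close>.\<close>
        define T where "T = insert l (S - {k, m})"
        have T: "T \<subseteq> K" using psubset.prems by (auto simp: T_def)
        have "g k w = 0" if w: "w \<in> face T" for w
        proof -
          define s t where "s = g k w / g k x" and "t = g m w / g m y"
          have "0 \<le> g k w" "0 \<le> g m w" using w 3 psubset.prems by (auto simp: face_iff)
          then have st: "0 \<le> s" "0 \<le> t" using x y by (auto simp: s_def t_def)
          have wA: "w \<in> A" using w by (simp add: face_iff)
          have lw: "g l w = 0" using w by (auto simp: face_iff T_def)
          \<comment> \<open>Moving against \<open>x - v\<close> and \<open>y - v\<close> cancels the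
            slacks of \<open>k\<close> and \<open>m\<close>. Then \<open>g l\<close> must vanish at
            \<open>w'\<close>, which makes a sum of two nonnegative terms zero.\<close>
          define w' where "w' = (w + (- s) *\<^sub>R (x - v)) + (- t) *\<^sub>R (y - v)"
          have g': "g n w' = g n w - s * (g n x - g n v) - t * (g n y - g n v)" for n
            by (simp add: w'_def g_add_diff del: scaleR_minus_left)
          have "w' \<in> A" unfolding w'_def
            using affine_A inA wA by (intro mem_affine_3_minus)
          moreover have "g n w' = 0" if n: "n \<in> S" for n
          proof -
            consider "n = k" | "n = m" | "n \<in> S - {k, m}" using n by blast
            then show ?thesis
            proof cases
              case 1
              then show ?thesis using 3 x v0 y0[of k] by (simp add: g' s_def)
            next
              case 2
              then show ?thesis using 3 y v0 x0[of m] by (simp add: g' t_def)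
            next
              case 3
              then have "g n w = 0" using w by (auto simp: face_iff T_def)
              then show ?thesis using 3 x0 y0 v0 by (simp add: g')
            qed
          qed
          ultimately have "g l w' = 0" using vanish_on_hull[of S l w'] zero psubset.prems by blast
          then have "s * g l x + t * g l y = 0" by (simp add: g' lw vl)
          moreover have "0 \<le> s * g l x" "0 \<le> t * g l y" using st x y by auto
          ultimately have "s * g l x = 0" by linarith
          then show ?thesis using x by (simp add: s_def)
        qed
        \<comment> \<open>The contributions of \<open>x\<close> and \<open>y\<close> to
          \<open>g l\<close> cancel, so \<open>z\<close> solves the equations of \<open>T\<close>,
          yet its slack for \<open>k\<close> is still positive.\<close>
        moreover define z where "z = (v + (1 / g l x) *\<^sub>R (x - v)) + (- 1 / g l y) *\<^sub>R (y - v)"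
        have gz: "g n z = g n v + (1 / g l x) * (g n x - g n v) + (- 1 / g l y) * (g n y - g n v)" for n
          by (simp only: z_def g_add_diff)
        have "z \<in> A" unfolding z_def using affine_A inA by (intro mem_affine_3_minus)
        moreover have "g n z = 0" if "n \<in> T" for n
          using that x y x0 y0 v0 vl by (auto simp: gz T_def)
        ultimately have "g k z = 0" using T vanish_on_hull[of T k z] by blast
        moreover have "g k z = g k x / g l x" using 3 v0 y0[of k] by (simp add: gz)
        ultimately show False using x by simp
      qed
    qed
  qed
  then obtain x where x: "x \<in> face S" "g l x \<noteq> 0" by blast
  then have "0 \<le> g l x" using assms(3) by (simp add: face_iff)
  then show ?thesis using x by (intro bexI[of _ x]) auto
qed

section \<open>Minimal sets of facets without a common point\<close>

text \<open>The missing faces of the simplicial complex formed by the \<open>S \<subseteq> K\<close>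
  with \<open>face S\<close> nonempty. They will index the simplex factors.\<close>

definition minimal_nonfaces :: "'k set set" where
  "minimal_nonfaces = {M. M \<subseteq> K \<and> face M = {} \<and> (\<forall>N. N \<subset> M \<longrightarrow> face N \<noteq> {})}"

lemma empty_face_imp_minimal_nonface:
  assumes "S \<subseteq> K" and "face S = {}"
  shows "\<exists>M\<in>minimal_nonfaces. M \<subseteq> S"
proof -
  have "finite S" using assms(1) finite_K finite_subset by blast
  then show ?thesis using assms
  proof (induction S rule: finite_psubset_induct)
    case (psubset S)
    show ?case
    proof (cases "S \<in> minimal_nonfaces")
      case False
      then obtain N where "N \<subset> S" "face N = {}"
        using psubset.prems by (auto simp: minimal_nonfaces_def)
      then show ?thesis using psubset.IH[of N] psubset.prems by blast
    qed blast
  qed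
qed

text \<open>By minimality there are points \<open>p k\<close> at which \<open>g k\<close> is the
  only nonzero slack from \<open>M\<close>; take \<open>c k\<close> to be the reciprocal of that
  slack. Where the weighted sum differs from 1, an affine combination yields a common zero of all
  \<open>g k\<close> with \<open>k \<in> M\<close>, although \<open>face M\<close> is empty.\<close>

lemma minimal_nonface_weights:
  assumes M: "M \<in> minimal_nonfaces"
  shows "\<exists>c. (\<forall>k\<in>M. 0 < c k) \<and> (\<forall>x\<in>A. (\<Sum>k\<in>M. c k * g k x) = 1)"
proof -
  have MK: "M \<subseteq> K" and empty: "face M = {}" using M by (auto simp: minimal_nonfaces_def)
  have fin: "finite M" using MK finite_K finite_subset by blast
  have "\<forall>k\<in>M. \<exists>x. x \<in> face (M - {k})"
    using M unfolding minimal_nonfaces_def by blast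
  then obtain p where p: "\<And>k. k \<in> M \<Longrightarrow> p k \<in> face (M - {k})" by metis
  have pA: "p k \<in> A" if "k \<in> M" for k using p[OF that] by (simp add: face_iff)
  have p0: "g j (p k) = 0" if "k \<in> M" "j \<in> M" "j \<noteq> k" for j k
    using p[OF that(1)] that by (simp add: face_iff)
  have pos: "0 < g k (p k)" if k: "k \<in> M" for k
  proof -
    have "p k \<notin> face M" using empty by blast
    then have "g k (p k) \<noteq> 0" using p[OF k] unfolding face_iff by blast
    then show ?thesis using p[OF k] k MK unfolding face_iff by force
  qed
  define c where "c k = 1 / g k (p k)" for k
  have "(\<Sum>k\<in>M. c k * g k x) = 1" if x: "x \<in> A" for x
  proof (rule ccontr)
    assume ne: "(\<Sum>k\<in>M. c k * g k x) \<noteq> 1"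
    define s where "s = (\<Sum>k\<in>M. c k * g k x)"
    \<comment> \<open>With \<open>s\<close> the weighted sum, this is \<open>x\<close> minus the sum
      of the \<open>(c k * g k x) *\<^sub>R p k\<close>, divided by \<open>1 - s\<close>. Since
      \<open>c k * g k (p k) = 1\<close>, every slack from \<open>M\<close> cancels.\<close>
    define y where "y = x + (\<Sum>k\<in>M. (c k * g k x / (1 - s)) *\<^sub>R (x - p k))"
    have s: "1 - s \<noteq> 0" using ne by (simp add: s_def)
    have "y \<in> A" unfolding y_def using affine_A x fin pA by (intro affine_add_sum_diff) auto
    moreover have "g j y = 0" if j: "j \<in> M" for j
    proof -
      have "g j y = g j x + (\<Sum>k\<in>M. c k * g k x / (1 - s) * (g j x - g j (p k)))"
        unfolding y_def by (rule g_add_sum_diff)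
      also have "\<dots> = g j x + (\<Sum>k\<in>M. c k * g k x / (1 - s) * g j x)
          - (\<Sum>k\<in>M. c k * g k x / (1 - s) * g j (p k))"
        by (simp add: right_diff_distrib sum_subtractf)
      also have "(\<Sum>k\<in>M. c k * g k x / (1 - s) * g j x) = s / (1 - s) * g j x"
        by (simp add: s_def sum_distrib_right sum_divide_distrib)
      also have "(\<Sum>k\<in>M. c k * g k x / (1 - s) * g j (p k))
          = (\<Sum>k\<in>M. if k = j then c k * g k x / (1 - s) * g j (p k) else 0)"
        using p0[OF _ j] by (intro sum.cong) auto
      also have "\<dots> = g j x / (1 - s)" using fin j pos[OF j] by (simp add: c_def)
      finally show ?thesis using s by (simp add: field_simps)
    qed
    ultimately have "y \<in> affine hull (face M)" using hull[OF MK] by blast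
    then show False using empty by simp
  qed
  then show ?thesis using pos by (intro exI[of _ c]) (auto simp: c_def)
qed

text \<open>The two weight relations agree on \<open>M \<inter> N\<close>, so their difference
  equates a sum over \<open>M - N\<close> with one over \<open>N - M\<close>. On the nonempty
  \<open>face (M - N)\<close> all slacks from \<open>N - M\<close> then vanish, against
  \<open>face_not_subset_facet\<close>.\<close>

lemma minimal_nonfaces_disjoint:
  assumes M: "M \<in> minimal_nonfaces" and N: "N \<in> minimal_nonfaces" and "M \<inter> N \<noteq> {}"
  shows "M = N"
proof (rule ccontr)
  assume ne: "M \<noteq> N"
  have MK: "M \<subseteq> K" "N \<subseteq> K" using M N by (auto simp: minimal_nonfaces_def)
  have fin: "finite M" "finite N" using MK finite_K finite_subset by blast+
  obtain c where c: "\<And>k. k \<in> M \<Longrightarrow> 0 < c k" "\<And>x. x \<in> A \<Longrightarrow> (\<Sum>k\<in>M. c k * g k x) = 1"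
    using minimal_nonface_weights[OF M] by blast
  obtain d where d: "\<And>k. k \<in> N \<Longrightarrow> 0 < d k" "\<And>x. x \<in> A \<Longrightarrow> (\<Sum>k\<in>N. d k * g k x) = 1"
    using minimal_nonface_weights[OF N] by blast
  \<comment> \<open>At a point of \<open>face (X - {k})\<close> the first relation reduces to its
    term for \<open>k\<close>, while that term is only one of the nonnegative summands of the
    second. Exchanging the roles gives equality.\<close>
  have le: "d k \<le> c k"
    if X: "X \<in> minimal_nonfaces" "X \<subseteq> K" "finite X" and Y: "Y \<subseteq> K" "finite Y" and k: "k \<in> X" "k \<in> Y"
      and c: "\<And>k. k \<in> X \<Longrightarrow> 0 < c k" "\<And>x. x \<in> A \<Longrightarrow> (\<Sum>k\<in>X. c k * g k x) = 1"
      and d: "\<And>k. k \<in> Y \<Longrightarrow> 0 < d k" "\<And>x. x \<in> A \<Longrightarrow> (\<Sum>k\<in>Y. d k * g k x) = 1"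
    for X Y :: "'k set" and c d k
  proof -
    obtain x where x: "x \<in> face (X - {k})" using X k unfolding minimal_nonfaces_def by blast
    have xA: "x \<in> A" using x by (simp add: face_iff)
    have "(\<Sum>j\<in>X. c j * g j x) = c k * g k x + (\<Sum>j\<in>X - {k}. c j * g j x)"
      using X k by (simp add: sum.remove)
    also have "(\<Sum>j\<in>X - {k}. c j * g j x) = 0"
      using x by (intro sum.neutral) (auto simp: face_iff)
    finally have 1: "c k * g k x = 1" using c(2)[OF xA] by simp
    have "d k * g k x \<le> (\<Sum>j\<in>Y. d j * g j x)"
      using k Y x d(1) by (intro member_le_sum) (auto simp: face_iff less_imp_le subset_iff)
    then have "d k * g k x \<le> c k * g k x" using 1 d(2)[OF xA] by simp
    moreover have "0 < g k x" using 1 c(1)[OF k(1)] by (metis zero_less_mult_pos zero_less_one)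
    ultimately show ?thesis by simp
  qed
  have eq: "c k = d k" if "k \<in> M \<inter> N" for k
    using le[of M N k c d] le[of N M k d c] that M N MK fin c d by force
  have sum_eq: "(\<Sum>k\<in>M - N. c k * g k x) = (\<Sum>k\<in>N - M. d k * g k x)" if "x \<in> A" for x
  proof -
    have "(\<Sum>k\<in>M. c k * g k x) = (\<Sum>k\<in>M \<inter> N. c k * g k x) + (\<Sum>k\<in>M - N. c k * g k x)"
      using fin by (rule_tac sum.Int_Diff)
    moreover have "(\<Sum>k\<in>N. d k * g k x) = (\<Sum>k\<in>M \<inter> N. d k * g k x) + (\<Sum>k\<in>N - M. d k * g k x)"
      using fin sum.Int_Diff[of N _ M] by (simp add: Int_commute)
    moreover have "(\<Sum>k\<in>M \<inter> N. c k * g k x) = (\<Sum>k\<in>M \<inter> N. d k * g k x)"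
      using eq by (intro sum.cong) auto
    ultimately show ?thesis using c(2)[OF that] d(2)[OF that] by simp
  qed
  have "\<not> N \<subset> M" using M N unfolding minimal_nonfaces_def by blast
  then obtain l where l: "l \<in> N" "l \<notin> M" using ne by blast
  have "M - N \<subset> M" using \<open>M \<inter> N \<noteq> {}\<close> by blast
  then have "face (M - N) \<noteq> {}" using M unfolding minimal_nonfaces_def by blast
  then obtain x where x: "x \<in> face (M - N)" "0 < g l x"
    using face_not_subset_facet[of "M - N" l] l MK by blast
  have "(\<Sum>k\<in>N - M. d k * g k x) = 0"
    using sum_eq[of x] x by (simp add: face_iff)
  moreover have "0 \<le> d k * g k x" if "k \<in> N - M" for k
    using that x d(1) MK by (auto simp: face_iff less_imp_le subset_iff)
  ultimately have "d l * g l x = 0"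
    using fin l sum_nonneg_eq_0_iff[of "N - M" "\<lambda>k. d k * g k x"] by auto
  then show False using d(1)[of l] l x by simp
qed

section \<open>Independent slacks and boundedness\<close>

text \<open>Deleting one representative of each minimal nonface leaves a set that contains none of
  them, so its face is nonempty. Disjointness ensures that each loses only its own representative.
  In a product of simplices such a \<open>v\<close> is a vertex.\<close>

lemma exists_transversal_complement:
  "\<exists>S v. S \<subseteq> K \<and> v \<in> face S \<and> K - \<Union>minimal_nonfaces \<subseteq> S \<and>
    (\<forall>M\<in>minimal_nonfaces. \<exists>k\<in>M. M - {k} \<subseteq> S \<and> k \<notin> S)"
proof -
  have ne: "M \<noteq> {}" if "M \<in> minimal_nonfaces" for M
    using that nonempty by (auto simp: minimal_nonfaces_def)
  then obtain r where r: "\<And>M. M \<in> minimal_nonfaces \<Longrightarrow> r M \<in> M" by (metis equals0I)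
  define S where "S = K - r ` minimal_nonfaces"
  have "face S \<noteq> {}"
  proof
    assume "face S = {}"
    then obtain M where "M \<in> minimal_nonfaces" "M \<subseteq> S"
      using empty_face_imp_minimal_nonface[of S] by (auto simp: S_def)
    then show False using r by (auto simp: S_def)
  qed
  then obtain v where "v \<in> face S" by blast
  moreover have "\<exists>k\<in>M. M - {k} \<subseteq> S \<and> k \<notin> S" if M: "M \<in> minimal_nonfaces" for M
  proof (intro bexI conjI)
    show "r M \<in> M" using r M by blast
    show "M - {r M} \<subseteq> S"
    proof
      fix j assume j: "j \<in> M - {r M}"
      have "j \<noteq> r N" if N: "N \<in> minimal_nonfaces" for N
        using minimal_nonfaces_disjoint[OF M N] j r[OF N] by blast
      then show "j \<in> S" using j M by (auto simp: S_def minimal_nonfaces_def)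
    qed
    show "r M \<notin> S" using M by (simp add: S_def)
  qed
  moreover have "K - \<Union>minimal_nonfaces \<subseteq> S" using r by (auto simp: S_def)
  ultimately show ?thesis unfolding S_def by blast
qed

text \<open>\<open>face_not_subset_facet\<close> provides, for each \<open>k \<in> S\<close>, a
  direction from \<open>v\<close> that changes \<open>g k\<close> and no other slack from
  \<open>S\<close>; these directions are dual to the slacks up to scaling.\<close>

lemma exists_prescribed_values:
  assumes S: "S \<subseteq> K" and v: "v \<in> face S"
  shows "\<exists>x\<in>A. \<forall>k\<in>S. g k x = y k"
proof -
  have fin: "finite S" using S finite_K finite_subset by blast
  have "\<exists>x\<in>face (S - {k}). 0 < g k x" if "k \<in> S" for k
    using face_not_subset_facet[of "S - {k}" k] face_antimono[of "S - {k}" S] S v that by blast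
  then obtain p where p: "\<And>k. k \<in> S \<Longrightarrow> p k \<in> face (S - {k})" "\<And>k. k \<in> S \<Longrightarrow> 0 < g k (p k)"
    by metis
  define x where "x = v + (\<Sum>k\<in>S. (y k / g k (p k)) *\<^sub>R (p k - v))"
  have "x \<in> A" unfolding x_def
    using affine_A fin v p(1) by (intro affine_add_sum_diff) (auto simp: face_iff)
  moreover have "g j x = y j" if j: "j \<in> S" for j
  proof -
    have v0: "g j v = 0" using v j by (simp add: face_iff)
    have "g j x = (\<Sum>k\<in>S. y k / g k (p k) * g j (p k))"
      unfolding x_def g_add_sum_diff by (simp add: v0)
    also have "\<dots> = (\<Sum>k\<in>S. if k = j then y j else 0)"
    proof (rule sum.cong)
      fix k assume k: "k \<in> S"
      show "y k / g k (p k) * g j (p k) = (if k = j then y j else 0)"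
        using p[OF k] j by (auto simp: face_iff)
    qed simp
    finally show ?thesis using fin j by simp
  qed
  ultimately show ?thesis by blast
qed

text \<open>Otherwise a ray in direction \<open>y - x\<close> from any point of the polytope would
  stay inside it, against boundedness.\<close>

lemma recession_direction_zero:
  assumes "x \<in> A" "y \<in> A" and "\<And>k. k \<in> K \<Longrightarrow> g k x \<le> g k y"
  shows "x = y"
proof (rule ccontr)
  assume ne: "x \<noteq> y"
  obtain p where p: "p \<in> face {}" using nonempty by blast
  obtain B where B: "\<And>z. z \<in> face {} \<Longrightarrow> norm z \<le> B" using bounded by (auto simp: bounded_iff)
  \<comment> \<open>Makes the displacement have norm \<open>B + norm p + 1\<close>, one more than
    the bound allows.\<close>
  define t where "t = (B + norm p + 1) / norm (y - x)"
  have "0 \<le> B" using B[OF p] norm_ge_zero order_trans by blast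
  then have t: "0 \<le> t" by (simp add: t_def)
  have "p + t *\<^sub>R (y - x) \<in> face {}"
    using p assms t affine_A unfolding face_iff g_add_diff by (auto intro: mem_affine_3_minus)
  then have "norm (p + t *\<^sub>R (y - x)) \<le> B" by (rule B)
  then have "norm (t *\<^sub>R (y - x)) \<le> B + norm p"
    using norm_triangle_ineq4[of "p + t *\<^sub>R (y - x)" p] by simp
  moreover have "norm (t *\<^sub>R (y - x)) = B + norm p + 1"
    using ne \<open>0 \<le> B\<close> by (simp add: t_def)
  ultimately show False by simp
qed

text \<open>Used to recover the slack of the representative deleted from \<open>M\<close>.\<close>

lemma weighted_sum_determines:
  assumes M: "M \<in> minimal_nonfaces" and k: "k \<in> M"
    and c: "0 < c k" "(\<Sum>j\<in>M. c j * u j) = (1::real)" "(\<Sum>j\<in>M. c j * w j) = 1"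
    and eq: "\<And>j. j \<in> M - {k} \<Longrightarrow> u j = w j"
  shows "u k = w k"
proof -
  have fin: "finite M" using M finite_K finite_subset by (auto simp: minimal_nonfaces_def)
  have "c k * u k + (\<Sum>j\<in>M - {k}. c j * u j) = c k * w k + (\<Sum>j\<in>M - {k}. c j * w j)"
    using c(2,3) sum.remove[OF fin k, of "\<lambda>j. c j * u j"] sum.remove[OF fin k, of "\<lambda>j. c j * w j"]
    by simp
  moreover have "(\<Sum>j\<in>M - {k}. c j * u j) = (\<Sum>j\<in>M - {k}. c j * w j)"
    using eq by (intro sum.cong) auto
  ultimately show ?thesis using c(1) by simp
qed

text \<open>If \<open>u\<close> lies in no minimal nonface, its slack can be raised from
  \<open>v\<close> with all others in \<open>K\<close> fixed: those in \<open>S\<close> by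
  prescription, the rest by weight relations that do not involve \<open>u\<close>. This is a
  recession direction.\<close>

lemma Union_minimal_nonfaces: "\<Union>minimal_nonfaces = K"
proof
  show "\<Union>minimal_nonfaces \<subseteq> K" by (auto simp: minimal_nonfaces_def)
  show "K \<subseteq> \<Union>minimal_nonfaces"
  proof (rule ccontr)
    assume "\<not> ?thesis"
    then obtain u where u: "u \<in> K" "u \<notin> \<Union>minimal_nonfaces" by blast
    obtain S v where S: "S \<subseteq> K" and v: "v \<in> face S"
      and tr: "\<And>M. M \<in> minimal_nonfaces \<Longrightarrow> \<exists>k\<in>M. M - {k} \<subseteq> S \<and> k \<notin> S"
      and rest: "K - \<Union>minimal_nonfaces \<subseteq> S"
      using exists_transversal_complement by metis
    have uS: "u \<in> S" using u rest by blast
    obtain x where x: "x \<in> A" "\<And>k. k \<in> S \<Longrightarrow> g k x = (if k = u then 1 else 0)"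
      using exists_prescribed_values[OF S v, of "\<lambda>k. if k = u then 1 else 0"] by blast
    have vA: "v \<in> A" and v0: "\<And>k. k \<in> S \<Longrightarrow> g k v = 0" using v by (auto simp: face_iff)
    have "g k v \<le> g k x" if k: "k \<in> K" for k
    proof (cases "k \<in> S")
      case True
      then show ?thesis using x v0 by simp
    next
      case False
      then obtain M where M: "M \<in> minimal_nonfaces" "k \<in> M" using k rest by blast
      obtain c where c: "\<And>k. k \<in> M \<Longrightarrow> 0 < c k" "\<And>x. x \<in> A \<Longrightarrow> (\<Sum>k\<in>M. c k * g k x) = 1"
        using minimal_nonface_weights[OF M(1)] by blast
      have sub: "M - {k} \<subseteq> S" using tr[OF M(1)] M(2) False by blast
      have "g k v = g k x"
      proof (rule weighted_sum_determines[OF M, of c])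
        fix j assume "j \<in> M - {k}"
        then have "j \<in> S" "j \<noteq> u" using sub u M by auto
        then show "g j v = g j x" using v0 x by simp
      qed (use c M vA x in auto)
      then show ?thesis by simp
    qed
    then have "v = x" by (rule recession_direction_zero[OF vA x(1)])
    then show False using x(2)[OF uS] v0[OF uS] by simp
  qed
qed

text \<open>Surjectivity onto the product: the values on \<open>S\<close> can be chosen freely, and
  the one remaining value in each minimal nonface is forced by its weight relation.\<close>

lemma exists_point_of_weighted_values:
  assumes c: "\<And>M k. M \<in> minimal_nonfaces \<Longrightarrow> k \<in> M \<Longrightarrow> 0 < c M k"
    "\<And>M x. M \<in> minimal_nonfaces \<Longrightarrow> x \<in> A \<Longrightarrow> (\<Sum>k\<in>M. c M k * g k x) = 1"
    and y: "\<And>M. M \<in> minimal_nonfaces \<Longrightarrow> (\<Sum>k\<in>M. c M k * y k) = 1"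
  shows "\<exists>x\<in>A. \<forall>k\<in>K. g k x = y k"
proof -
  obtain S v where S: "S \<subseteq> K" and v: "v \<in> face S"
    and tr: "\<And>M. M \<in> minimal_nonfaces \<Longrightarrow> \<exists>k\<in>M. M - {k} \<subseteq> S \<and> k \<notin> S"
    using exists_transversal_complement by metis
  obtain x where x: "x \<in> A" "\<And>k. k \<in> S \<Longrightarrow> g k x = y k"
    using exists_prescribed_values[OF S v, of y] by blast
  have "g k x = y k" if k: "k \<in> K" for k
  proof (cases "k \<in> S")
    case False
    obtain M where M: "M \<in> minimal_nonfaces" "k \<in> M" using k Union_minimal_nonfaces by blast
    have sub: "M - {k} \<subseteq> S" using tr[OF M(1)] M(2) False by blast
    show ?thesis
    proof (rule weighted_sum_determines[OF M, of "c M"])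
      fix j assume "j \<in> M - {k}"
      then show "g j x = y j" using sub x by blast
    qed (use c M y x in auto)
  qed (use x in blast)
  then show ?thesis using x by blast
qed

section \<open>Barycentric coordinates from weighted slacks\<close>

lemma g_affine: "g k (u *\<^sub>R x + (1 - u) *\<^sub>R y) = u * g k x + (1 - u) * g k y"
  by (simp add: g_def inner_add_right algebra_simps)

text \<open>Each minimal nonface gives one row of coordinates, its weighted slacks. Injectivity
  comes from \<open>recession_direction_zero\<close>, surjectivity from
  \<open>exists_point_of_weighted_values\<close>.\<close>

lemma aff_equiv_prod_simplices_face_empty: "aff_equiv_prod_simplices (face {})"
proof -
  have MK: "M \<subseteq> K" "finite M" "M \<noteq> {}" if "M \<in> minimal_nonfaces" for M
    using that nonempty finite_K finite_subset by (auto simp: minimal_nonfaces_def)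
  obtain c where c: "\<And>M k. M \<in> minimal_nonfaces \<Longrightarrow> k \<in> M \<Longrightarrow> 0 < c M k"
    "\<And>M x. M \<in> minimal_nonfaces \<Longrightarrow> x \<in> A \<Longrightarrow> (\<Sum>k\<in>M. c M k * g k x) = 1"
    using minimal_nonface_weights by metis
  have "finite minimal_nonfaces"
    using finite_K by (rule_tac finite_subset[of _ "Pow K"]) (auto simp: minimal_nonfaces_def)
  then obtain Ms where Ms: "set Ms = minimal_nonfaces" "distinct Ms"
    using finite_distinct_list by blast
  have MsI: "Ms ! i \<in> minimal_nonfaces" if "i < length Ms" for i using nth_mem[OF that] Ms(1) by simp
  \<comment> \<open>A simplex of dimension \<open>d\<close> has coordinates 0 to \<open>d\<close>,
    hence the shift by one; \<open>M\<close> is nonempty, so the subtraction does not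
    truncate.\<close>
  have "\<exists>e. bij_betw e {..card M - 1} M" if M: "M \<in> minimal_nonfaces" for M
  proof -
    have "0 < card M" using MK[OF M] by (simp add: card_gt_0_iff)
    then have "{..card M - 1} = {0..<card M}" by auto
    then show ?thesis using ex_bij_betw_nat_finite[OF MK(2)[OF M]] by simp
  qed
  then obtain e where e: "\<And>M. M \<in> minimal_nonfaces \<Longrightarrow> bij_betw (e M) {..card M - 1} M" by metis
  define ds where "ds = map (\<lambda>M. card M - 1) Ms"
  have len: "length ds = length Ms" and nth: "\<And>i. i < length Ms \<Longrightarrow> ds ! i = card (Ms ! i) - 1"
    by (auto simp: ds_def)
  have bij: "bij_betw (e (Ms ! i)) {..ds ! i} (Ms ! i)" if "i < length Ms" for i
    using e[OF MsI[OF that]] nth[OF that] by simp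
  \<comment> \<open>Position \<open>(i, j)\<close> stands for the \<open>j\<close>-th facet of the
    \<open>i\<close>-th factor. Covering makes \<open>E\<close> map \<open>D\<close> onto
    \<open>K\<close>, disjointness makes it injective.\<close>
  define E where "E = (\<lambda>(i, j). e (Ms ! i) j)"
  define D where "D = (SIGMA i:{..<length Ms}. {..ds ! i})"
  have E_mem: "E (i, j) \<in> Ms ! i" if "(i, j) \<in> D" for i j
    using bij[of i] that by (auto simp: D_def E_def dest: bij_betwE)
  have E_img: "\<exists>i j. (i, j) \<in> D \<and> E (i, j) = k" if k: "k \<in> K" for k
  proof -
    obtain M where "M \<in> minimal_nonfaces" "k \<in> M" using k Union_minimal_nonfaces by blast
    then obtain i where i: "i < length Ms" "k \<in> Ms ! i" using Ms by (metis in_set_conv_nth)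
    then have "k \<in> e (Ms ! i) ` {..ds ! i}" using bij[of i] by (simp add: bij_betw_def)
    then show ?thesis using i by (auto simp: D_def E_def)
  qed
  have E_K: "E (i, j) \<in> K" if "(i, j) \<in> D" for i j
    using E_mem[OF that] MK(1)[OF MsI, of i] that by (auto simp: D_def)
  have inj_E: "inj_on E D"
  proof (rule inj_onI, clarify)
    fix i j i' j' assume ij: "(i, j) \<in> D" "(i', j') \<in> D" and eq: "E (i, j) = E (i', j')"
    have i: "i < length Ms" "i' < length Ms" using ij by (auto simp: D_def)
    have "Ms ! i \<inter> Ms ! i' \<noteq> {}" using E_mem[OF ij(1)] E_mem[OF ij(2)] eq by auto
    then have "Ms ! i = Ms ! i'" using minimal_nonfaces_disjoint MsI i by blast
    then have "i = i'" using Ms i by (simp add: nth_eq_iff_index_eq)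
    moreover have "j = j'"
      using bij_betw_imp_inj_on[OF bij[OF i(1)]] ij eq \<open>i = i'\<close> by (auto simp: D_def E_def dest: inj_onD)
    ultimately show "i = i' \<and> j = j'" by simp
  qed
  have row: "(\<Sum>j\<le>ds ! i. h (E (i, j))) = (\<Sum>k\<in>Ms ! i. h k)" if "i < length Ms" for i and h :: "'k \<Rightarrow> real"
    using sum.reindex_bij_betw[OF bij[OF that], of h] by (simp add: E_def)
  define f where "f x i j = (if (i, j) \<in> D then c (Ms ! i) (E (i, j)) * g (E (i, j)) x else 0)" for x i j
  have c_pos: "0 < c (Ms ! i) (E (i, j))" if "(i, j) \<in> D" for i j
    using c(1)[OF MsI E_mem[OF that]] that by (simp add: D_def)
  have f_row: "(\<Sum>j\<le>ds ! i. f x i j) = 1" if i: "i < length Ms" and x: "x \<in> A" for x i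
  proof -
    have "(\<Sum>j\<le>ds ! i. f x i j) = (\<Sum>j\<le>ds ! i. c (Ms ! i) (E (i, j)) * g (E (i, j)) x)"
      using i by (intro sum.cong) (auto simp: f_def D_def)
    also have "\<dots> = 1" using row[OF i, of "\<lambda>k. c (Ms ! i) k * g k x"] c(2)[OF MsI[OF i] x] by simp
    finally show ?thesis .
  qed
  have "coord_affine f"
    unfolding coord_affine_def f_def by (auto simp only: g_affine distrib_left mult.left_commute split: if_splits)
  moreover have "inj_on f (affine hull (face {}))"
  proof (rule inj_onI)
    fix x y assume "x \<in> affine hull (face {})" "y \<in> affine hull (face {})" and eq: "f x = f y"
    moreover have "affine hull (face {}) \<subseteq> A"
      by (intro hull_minimal affine_A) (auto simp: face_iff)
    ultimately have xy: "x \<in> A" "y \<in> A" by auto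
    show "x = y"
    proof (rule recession_direction_zero[OF xy])
      fix k assume "k \<in> K"
      then obtain i j where ij: "(i, j) \<in> D" "E (i, j) = k" using E_img by blast
      have "f x i j = f y i j" using eq by simp
      then have "g k x = g k y" using ij c_pos[OF ij(1)] by (simp add: f_def)
      then show "g k x \<le> g k y" by simp
    qed
  qed
  moreover have "f ` face {} = prod_simplices ds"
  proof (intro equalityI subsetI)
    fix y assume "y \<in> f ` face {}"
    then obtain x where x: "x \<in> face {}" "y = f x" by blast
    have "0 \<le> f x i j" for i j
      using c_pos[of i j] E_K[of i j] x by (auto simp: f_def face_iff)
    moreover have "f x i j = 0" if "\<not> (i < length ds \<and> j \<le> ds ! i)" for i j
      using that by (auto simp: f_def D_def len)
    ultimately show "y \<in> prod_simplices ds"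
      using x f_row unfolding prod_simplices_def by (simp add: len face_iff)
  next
    fix y assume y: "y \<in> prod_simplices ds"
    \<comment> \<open>The slacks that a preimage of \<open>y\<close> must have, obtained by dividing
      out the weights.\<close>
    define z where "z k = (case inv_into D E k of (i, j) \<Rightarrow> y i j / c (Ms ! i) k)" for k
    have z: "z (E (i, j)) = y i j / c (Ms ! i) (E (i, j))" if "(i, j) \<in> D" for i j
      using inv_into_f_f[OF inj_E that] by (simp add: z_def)
    have "(\<Sum>k\<in>M. c M k * z k) = 1" if M: "M \<in> minimal_nonfaces" for M
    proof -
      obtain i where i: "i < length Ms" "M = Ms ! i" using M Ms by (metis in_set_conv_nth)
      have "(\<Sum>k\<in>M. c M k * z k) = (\<Sum>j\<le>ds ! i. c (Ms ! i) (E (i, j)) * z (E (i, j)))"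
        using row[OF i(1), of "\<lambda>k. c M k * z k"] i by simp
      also have "\<dots> = (\<Sum>j\<le>ds ! i. y i j)"
      proof (rule sum.cong)
        fix j assume "j \<in> {..ds ! i}"
        then have "(i, j) \<in> D" using i by (simp add: D_def)
        then show "c (Ms ! i) (E (i, j)) * z (E (i, j)) = y i j" using z c_pos[of i j] by simp
      qed simp
      also have "\<dots> = 1" using y i by (simp add: prod_simplices_def len)
      finally show ?thesis .
    qed
    then obtain x where x: "x \<in> A" "\<And>k. k \<in> K \<Longrightarrow> g k x = z k"
      using exists_point_of_weighted_values[of c z] c by blast
    have y_nonneg: "0 \<le> y i j" if "(i, j) \<in> D" for i j
      using y that by (auto simp: prod_simplices_def D_def len)
    have "0 \<le> g k x" if k: "k \<in> K" for k
    proof -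
      obtain i j where ij: "(i, j) \<in> D" "E (i, j) = k" using E_img[OF k] by blast
      then show ?thesis using x(2)[OF k] z[OF ij(1)] y_nonneg[OF ij(1)] c_pos[OF ij(1)] by simp
    qed
    then have "x \<in> face {}" using x by (simp add: face_iff)
    moreover have "f x = y"
    proof (intro ext)
      fix i j
      show "f x i j = y i j"
      proof (cases "(i, j) \<in> D")
        case True
        then show ?thesis using x(2)[OF E_K[OF True]] z[OF True] c_pos[OF True] by (simp add: f_def)
      next
        case False
        then show ?thesis using y by (auto simp: f_def prod_simplices_def D_def len)
      qed
    qed
    ultimately show "y \<in> f ` face {}" by blast
  qed
  ultimately show ?thesis unfolding aff_equiv_prod_simplices_def by blast
qed

end

section \<open>Irredundant inequalities of a polytope\<close>

text \<open>A minimal family \<open>H\<close> of halfspaces cutting \<open>P\<close> out of its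
  affine hull instantiates the locale, with the halfspaces themselves as indices.\<close>

lemma affine_hull_Inter_faces_imp_prod_simplices:
  fixes P :: "'a::euclidean_space set"
  assumes P: "polytope P" "P \<noteq> {}"
    and Inter: "\<And>\<F>. \<F> \<subseteq> {F. F face_of P} \<Longrightarrow> affine hull (\<Inter>\<F>) = (\<Inter>F\<in>\<F>. affine hull F)"
  shows "aff_equiv_prod_simplices P"
proof -
  define A where "A = affine hull P"
  obtain H where H: "finite H" "P = affine hull P \<inter> \<Inter>H"
      "\<forall>h\<in>H. \<exists>a b. a \<noteq> 0 \<and> h = {x. a \<bullet> x \<le> b}"
      "\<And>H'. H' \<subset> H \<Longrightarrow> P \<subset> affine hull P \<inter> \<Inter>H'"
    using polytope_imp_polyhedron[OF P(1)] unfolding polyhedron_Int_affine_minimal by metis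
  then obtain a b where ab: "\<And>h. h \<in> H \<Longrightarrow> a h \<noteq> 0 \<and> h = {x. a h \<bullet> x \<le> b h}" by metis
  define g where "g h x = b h - a h \<bullet> x" for h x
  define face where "face S = {x \<in> A. (\<forall>k\<in>H. 0 \<le> g k x) \<and> (\<forall>k\<in>S. g k x = 0)}" for S
  have mem_h: "x \<in> h \<longleftrightarrow> 0 \<le> g h x" if "h \<in> H" for x h
    using ab[OF that] by (auto simp: g_def)
  have face_empty: "face {} = P"
    using H(2) mem_h by (auto simp: face_def A_def)
  have g_aff: "g k (u *\<^sub>R x + (1 - u) *\<^sub>R y) = u * g k x + (1 - u) * g k y" for k u x y
    by (simp add: g_def inner_add_right algebra_simps)
  have affA: "affine A" by (simp add: A_def)
  have "rel_interior P \<noteq> {}" using P polytope_imp_convex rel_interior_eq_empty by blast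
  then obtain p where p: "p \<in> P" "\<And>h. h \<in> H \<Longrightarrow> 0 < g h p"
    using rel_interior_polyhedron_explicit[OF H(1,2) ab H(4)] by (auto simp: g_def)
  have pA: "p \<in> A" using p by (simp add: A_def hull_inc)
  \<comment> \<open>Dropping the halfspace \<open>k\<close> admits a point \<open>x\<close>
    violating only that inequality; the segment from \<open>x\<close> to the interior point
    \<open>p\<close> crosses its hyperplane where all other slacks are positive.\<close>
  have facet: "\<exists>z\<in>face {k}. \<forall>l\<in>H - {k}. 0 < g l z" if k: "k \<in> H" for k
  proof -
    have "P \<subset> A \<inter> \<Inter>(H - {k})" unfolding A_def by (rule H(4)) (use k in blast)
    then obtain x where x: "x \<in> A" "x \<in> \<Inter>(H - {k})" "x \<notin> P" by blast
    have xl: "0 \<le> g l x" if "l \<in> H - {k}" for l using x that mem_h[of l x] by blast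
    have xk: "g k x < 0" using x xl face_empty unfolding face_def by force
    define t where "t = g k p / (g k p - g k x)"
    have t: "0 < t" "t < 1" using p(2)[OF k] xk by (auto simp: t_def field_simps)
    define z where "z = t *\<^sub>R x + (1 - t) *\<^sub>R p"
    have "g k z = g k p - t * (g k p - g k x)" unfolding z_def g_aff by (simp add: algebra_simps)
    also have "\<dots> = 0" using p(2)[OF k] xk by (simp add: t_def)
    finally have zk: "g k z = 0" .
    have zl: "0 < g l z" if l: "l \<in> H - {k}" for l
      unfolding z_def g_aff using t xl[OF l] p(2)[of l] l by (intro add_nonneg_pos) auto
    have "0 \<le> g l z" if "l \<in> H" for l using zk zl[of l] that by (cases "l = k") auto
    moreover have "z \<in> A" unfolding z_def using affA x(1) pA by (intro mem_affine) auto
    ultimately show ?thesis using zk zl by (auto simp: face_def)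
  qed
  \<comment> \<open>From such a point \<open>z\<close> a short step towards any point of the
    hyperplane within \<open>A\<close> stays in the facet.\<close>
  have hull_facet: "{x \<in> A. g k x = 0} \<subseteq> affine hull (face {k})" if k: "k \<in> H" for k
  proof
    fix x assume x: "x \<in> {x \<in> A. g k x = 0}"
    obtain z where z: "z \<in> face {k}" "\<And>l. l \<in> H - {k} \<Longrightarrow> 0 < g l z" using facet[OF k] by blast
    then obtain e where e: "e > 0" "\<And>l. l \<in> H - {k} \<Longrightarrow> 0 \<le> g l z + e * (g l x - g l z)"
      using exists_common_step[of "H - {k}" "\<lambda>l. g l z" "\<lambda>l. g l x - g l z"] H(1) by auto
    define y where "y = e *\<^sub>R x + (1 - e) *\<^sub>R z"
    have gy: "g l y = g l z + e * (g l x - g l z)" for l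
      unfolding y_def g_aff by (simp add: algebra_simps)
    have yk: "g k y = 0" using x z by (simp add: gy face_def)
    then have "0 \<le> g l y" if "l \<in> H" for l using e(2)[of l] gy[of l] that by (cases "l = k") auto
    moreover have "y \<in> A" unfolding y_def using affA x z(1) by (intro mem_affine) (auto simp: face_def)
    ultimately have "y \<in> face {k}" using yk by (simp add: face_def)
    then show "x \<in> affine hull (face {k})"
      using affine_hull_extrapolate[OF z(1), of e x] e(1) by (simp add: y_def)
  qed
  have face_of: "face {k} face_of P" if "k \<in> H" for k
  proof -
    have "P \<inter> {x. a k \<bullet> x = b k} face_of P"
    proof (rule face_of_Int_supporting_hyperplane_le)
      show "convex P" using P polytope_imp_convex by blast
      show "a k \<bullet> x \<le> b k" if "x \<in> P" for x
        using that \<open>k \<in> H\<close> unfolding face_empty[symmetric] by (auto simp: face_def g_def)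
    qed
    moreover have "P \<inter> {x. a k \<bullet> x = b k} = face {k}"
      unfolding face_empty[symmetric] by (auto simp: face_def g_def)
    ultimately show ?thesis by simp
  qed
  interpret face_hull_system A H a b g face
  proof
    show "g k x = b k - a k \<bullet> x" for k x by (rule g_def)
    show "face S = {x \<in> A. (\<forall>k\<in>H. 0 \<le> g k x) \<and> (\<forall>k\<in>S. g k x = 0)}" for S by (rule face_def)
    show "affine A" by (rule affA)
    show "finite H" by (rule H(1))
    show "face {} \<noteq> {}" using P face_empty by simp
    show "bounded (face {})" using P(1) polytope_imp_bounded face_empty by simp
    show "\<exists>x\<in>face {}. g l x \<noteq> 0" if "l \<in> H" for l
      using p that face_empty by (intro bexI[of _ p]) (auto simp: less_imp_neq[symmetric])
    show "\<exists>x\<in>face {k}. g l x \<noteq> 0" if "k \<in> H" "l \<in> H" "k \<noteq> l" for k l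
      using facet[OF that(1)] that by (metis Diff_iff less_irrefl singletonD)
    show "{x \<in> A. \<forall>k\<in>S. g k x = 0} \<subseteq> affine hull (face S)" if S: "S \<subseteq> H" for S
    proof (cases "S = {}")
      \<comment> \<open>Treated apart, since the empty intersection of facets would be the whole
        space and not \<open>P\<close>.\<close>
      case True
      then show ?thesis by (simp add: face_empty A_def)
    next
      case False
      have "\<Inter>((\<lambda>k. face {k}) ` S) = face S" using False by (auto simp: face_def)
      moreover have "affine hull (\<Inter>((\<lambda>k. face {k}) ` S)) = (\<Inter>F\<in>(\<lambda>k. face {k}) ` S. affine hull F)"
        by (rule Inter) (use face_of S in auto)
      moreover have "{x \<in> A. \<forall>k\<in>S. g k x = 0} \<subseteq> (\<Inter>F\<in>(\<lambda>k. face {k}) ` S. affine hull F)"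
        using hull_facet S by blast
      ultimately show ?thesis by simp
    qed
  qed
  show ?thesis using aff_equiv_prod_simplices_face_empty face_empty by simp
qed

text \<open>Nonemptiness matters: the empty polytope satisfies the hull condition, but
  \<open>prod_simplices ds\<close> is never empty.\<close>

theorem theorem3:
  fixes P :: "'a::euclidean_space set"
  assumes "polytope P" and "P \<noteq> {}"
  shows "aff_equiv_prod_simplices P \<longleftrightarrow>
         (\<forall>\<F>. \<F> \<subseteq> {F. F face_of P} \<longrightarrow>
               affine hull (\<Inter>\<F>) = (\<Inter>F\<in>\<F>. affine hull F))"
  using prod_simplices_affine_hull_Inter_faces affine_hull_Inter_faces_imp_prod_simplices[OF assms]
  by blast

end
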